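(* For every integer $k\ge 1$ and every connected graph $G$ with at least $2$ vertices, $\textup{aw}(G\square C_{2k+1},3)=3$.
   Context: All graphs are finite, simple and undirected; $\textup{d}(u,v)$ denotes shortest-path distance. $C_n$ is the cycle on $n$ vertices. The Cartesian product $G\square H$ has vertex set $V(G)\times V(H)$, with $(x,y)$ adjacent to $(x',y')$ iff either $x=x'$ and $yy'\in E(H)$, or $y=y'$ and $xx'\in E(G)$. A 3-term arithmetic progression (3-AP) in a graph is a set of vertices $\{v_1,v_2,v_3\}$ (listed in some order) with $\textup{d}(v_1,v_2)=\textup{d}(v_2,v_3)$. An exact $r$-coloring of a graph $G$ is a surjective map $c:V(G)\to\{1,\dots,r\}$; a set of vertices is rainbow under $c$ if its vertices receive pairwise distinct colors. The anti-van der Waerden number $\textup{aw}(G,3)$ is the least positive integer $r$ such that every exact $r$-coloring of $G$ contains a rainbow 3-AP; if no coloring of $V(G)$ yields a rainbow 3-AP, then $\textup{aw}(G,3)=|V(G)|+1$. *)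

theory Defs
  imports
    "Graph_Theory.Digraph_Component"
    "Graph_Theory.Pair_Digraph"
    "Graph_Theory.Shortest_Path"
begin

text \<open>
  Finite simple undirected graphs are the records satisfying \<open>pair_graph\<close>: finite, loop-free,
  symmetric arc relation, no parallel arcs.
\<close>

definition cycle_graph :: "nat \<Rightarrow> nat pair_pre_digraph" where
  "cycle_graph n =
     \<lparr> pverts = {..<n},
       parcs = {(i, Suc i mod n) | i. i < n} \<union> {(Suc i mod n, i) | i. i < n} \<rparr>"

definition cart_prod :: "'a pair_pre_digraph \<Rightarrow> 'b pair_pre_digraph \<Rightarrow> ('a \<times> 'b) pair_pre_digraph"
    (infixl \<open>\<box>\<close> 70) where
  "G \<box> H =
     \<lparr> pverts = pverts G \<times> pverts H,
       parcs = {((x, y), (x', y')) | x y x' y'.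
          x = x' \<and> x \<in> pverts G \<and> (y, y') \<in> parcs H \<or>
          y = y' \<and> y \<in> pverts H \<and> (x, x') \<in> parcs G} \<rparr>"

text \<open>
  With unit weights, \<open>\<mu>\<close> is the least length of a walk; it is \<open>\<infinity>\<close> between different components.
\<close>

definition gdist :: "'a pair_pre_digraph \<Rightarrow> 'a \<Rightarrow> 'a \<Rightarrow> ereal" where
  "gdist G u v = wf_digraph.\<mu> (with_proj G) (\<lambda>_. 1) u v"

text \<open>
  The three vertices of a progression are distinct: otherwise singletons would be (vacuously
  rainbow) progressions.
\<close>

definition is_3ap :: "'a pair_pre_digraph \<Rightarrow> 'a set \<Rightarrow> bool" where
  "is_3ap G S \<longleftrightarrow> S \<subseteq> pverts G \<and> card S = 3 \<and>
     (\<exists>v1 v2 v3. S = {v1, v2, v3} \<and> gdist G v1 v2 = gdist G v2 v3)"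

definition exact_coloring :: "'a pair_pre_digraph \<Rightarrow> nat \<Rightarrow> ('a \<Rightarrow> nat) \<Rightarrow> bool" where
  "exact_coloring G r c \<longleftrightarrow> c ` pverts G = {1..r}"

definition rainbow :: "('a \<Rightarrow> nat) \<Rightarrow> 'a set \<Rightarrow> bool" where
  "rainbow c S \<longleftrightarrow> inj_on c S"

definition has_rainbow_3ap :: "'a pair_pre_digraph \<Rightarrow> ('a \<Rightarrow> nat) \<Rightarrow> bool" where
  "has_rainbow_3ap G c \<longleftrightarrow> (\<exists>S. is_3ap G S \<and> rainbow c S)"

definition aw3 :: "'a pair_pre_digraph \<Rightarrow> nat" where
  "aw3 G =
     (if \<exists>r c. exact_coloring G r c \<and> has_rainbow_3ap G c
      then LEAST r. 0 < r \<and> (\<forall>c. exact_coloring G r c \<longrightarrow> has_rainbow_3ap G c)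
      else card (pverts G) + 1)"

lemma pair_graph_cycle_graph:
  assumes "3 \<le> n"
  shows "pair_graph (cycle_graph n)"
proof -
  have fin: "finite ({(i, Suc i mod n) | i. i < n} \<union> {(Suc i mod n, i) | i. i < n})"
    by (rule finite_subset[of _ "{..<n} \<times> {..<n}"]) (use assms in auto)
  have noloop: "Suc i mod n \<noteq> i" "i \<noteq> Suc i mod n" if "i < n" for i
    using that assms by (cases "Suc i = n"; simp)+
  have "finite (parcs (cycle_graph n))"
    using fin by (simp add: cycle_graph_def)
  moreover have "symmetric (with_proj (cycle_graph n))"
    by (auto simp: cycle_graph_def symmetric_def sym_def)
  ultimately show ?thesis
    using assms noloop by unfold_locales (auto simp: cycle_graph_def)
qed

lemma pair_graph_cart_prod:
  assumes "pair_graph G" "pair_graph H"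
  shows "pair_graph (G \<box> H)"
proof -
  interpret G: pair_graph G by fact
  interpret H: pair_graph H by fact
  have "parcs (G \<box> H) \<subseteq> (pverts G \<times> pverts H) \<times> (pverts G \<times> pverts H)"
    by (auto simp: cart_prod_def dest: G.wellformed' H.wellformed')
  moreover have "finite (pverts G \<times> pverts H)"
    by simp
  ultimately have fin: "finite (parcs (G \<box> H))"
    by (meson finite_SigmaI finite_subset)
  show ?thesis
  proof unfold_locales
    show "finite (parcs (G \<box> H))" by (rule fin)
  qed (auto simp: cart_prod_def symmetric_def sym_def
        dest: G.wellformed' H.wellformed' G.no_loops' H.no_loops'
        intro: G.arcs_symmetric H.arcs_symmetric)
qed

lemma gdist_eq:
  assumes "pair_graph G"
  shows "gdist G u v = (INF p\<in>{p. pre_digraph.awalk (with_proj G) u p v}. ereal (real (length p)))"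
proof -
  interpret pair_graph G by fact
  show ?thesis
    by (simp add: gdist_def \<mu>_def awalk_cost_def sum_list_triv)
qed

end

theory Submission
  imports Defs
begin

text \<open>
  Distances in the product are sums of distances in the factors, so the cycle enters only through
  its distance function \<open>cdist k\<close> on integer positions modulo \<open>2 * k + 1\<close>. Consider a colouring
  without rainbow progressions. Along an odd cycle a progression can be centred at any position:
  two adjacent positions are either equidistant from it or differ by one, which a step in \<open>G\<close>
  compensates. From this, the two columns over an edge of \<open>G\<close> carry at most two colours, and if
  they are monochromatic of different colours then no third colour occurs anywhere. So if three
  colours occur, some column \<open>u\<close> has exactly two colours and misses a colour seen in some column
  \<open>z\<close>; for \<open>u\<close>, \<open>z\<close> as close as possible, the columns in between all have one and the same colour,
  and a progression centred either in \<open>z\<close> or halfway is rainbow.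
\<close>

section \<open>Distance on a cycle of odd length, with integer positions\<close>

definition cdist :: "nat \<Rightarrow> int \<Rightarrow> int \<Rightarrow> nat" where
  "cdist k i j = nat (min ((i - j) mod (2 * int k + 1)) (2 * int k + 1 - (i - j) mod (2 * int k + 1)))"

text \<open>The residue of least absolute value: as the modulus is odd, residues above
  \<open>k\<close> drop below zero when one period is subtracted. \<open>cdist_eqI\<close> and
  \<open>cdist_cases\<close> turn computations with \<open>cdist\<close> into linear arithmetic on
  such an \<open>s\<close>.\<close>

lemma cdist_representative:
  obtains s q where "i = j + s + (2 * int k + 1) * q" "\<bar>s\<bar> \<le> int k"
proof -
  let ?n = "2 * int k + 1"
  obtain a q where a: "0 \<le> a" "a < ?n" and eq: "i = j + a + ?n * q"
  proof (rule that)
    show "0 \<le> (i - j) mod ?n" by simp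
    show "(i - j) mod ?n < ?n" by (rule pos_mod_bound) simp
    show "i = j + (i - j) mod ?n + ?n * ((i - j) div ?n)"
      using mult_div_mod_eq[of ?n "i - j"] by linarith
  qed
  show thesis
  proof (cases "a \<le> int k")
    case True
    show ?thesis by (rule that[OF eq]) (use a True in simp)
  next
    case False
    have "i = j + (a - ?n) + ?n * (q + 1)"
      unfolding eq by (simp add: algebra_simps)
    then show ?thesis by (rule that) (use a False in simp)
  qed
qed

lemma cdist_eqI:
  assumes "i = j + s + (2 * int k + 1) * q" "\<bar>s\<bar> \<le> int k"
  shows "cdist k i j = nat \<bar>s\<bar>"
proof -
  let ?n = "2 * int k + 1"
  have "i - j = s + ?n * q" using assms by simp
  then have eq: "(i - j) mod ?n = s mod ?n" by (simp only: mod_mult_self2)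
  have "s mod ?n = (if s < 0 then s + ?n else s)"
  proof (cases "s < 0")
    case True
    have "s mod ?n = (s + ?n) mod ?n" by simp
    also have "\<dots> = s + ?n" using True assms by (intro mod_pos_pos_trivial) auto
    finally show ?thesis using True by simp
  qed (use assms in auto)
  then show ?thesis unfolding cdist_def eq using assms by auto
qed

lemma cdist_cases:
  obtains s q where "i = j + s + (2 * int k + 1) * q" "\<bar>s\<bar> \<le> int k" "cdist k i j = nat \<bar>s\<bar>"
  using cdist_representative[of i j k thesis] cdist_eqI by blast

lemma cdist_eq_abs: "\<bar>i - j\<bar> \<le> int k \<Longrightarrow> cdist k i j = nat \<bar>i - j\<bar>"
  by (rule cdist_eqI[where q = 0]) simp_all

lemma cdist_cong:
  assumes "i mod (2 * int k + 1) = i' mod (2 * int k + 1)" "j mod (2 * int k + 1) = j' mod (2 * int k + 1)"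
  shows "cdist k i j = cdist k i' j'"
  using mod_diff_cong[OF assms] by (simp add: cdist_def)

lemma cdist_commute: "cdist k i j = cdist k j i"
proof -
  obtain s q where *: "i = j + s + (2 * int k + 1) * q" "\<bar>s\<bar> \<le> int k" "cdist k i j = nat \<bar>s\<bar>"
    by (rule cdist_cases)
  have "cdist k j i = nat \<bar>- s\<bar>"
    by (rule cdist_eqI[where q = "- q"]) (use * in \<open>simp_all add: algebra_simps\<close>)
  then show ?thesis using * by simp
qed

lemma cdist_self [simp]: "cdist k i i = 0"
  by (simp add: cdist_eq_abs)

lemma cdist_le: "cdist k i j \<le> k"
  by (rule cdist_cases[of i j k]) simp

text \<open>Going \<open>k + 1\<close> steps one way around ends where \<open>k\<close> steps the
  other way do.\<close>

lemma cdist_offset_antipode: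
  assumes "\<bar>s\<bar> = int k + 1"
  shows "cdist k (j + s) j = k"
proof (cases "s > 0")
  case True
  then have "cdist k (j + s) j = nat \<bar>- int k\<bar>"
    by (intro cdist_eqI[where q = 1]) (use assms in simp_all)
  then show ?thesis by simp
next
  case False
  then have "cdist k (j + s) j = nat \<bar>int k\<bar>"
    by (intro cdist_eqI[where q = "-1"]) (use assms in simp_all)
  then show ?thesis by simp
qed

lemma cdist_Suc_le: "cdist k (i + 1) j \<le> Suc (cdist k i j)" "cdist k i j \<le> Suc (cdist k (i + 1) j)"
proof -
  obtain s q where *: "i = j + s + (2 * int k + 1) * q" "\<bar>s\<bar> \<le> int k" "cdist k i j = nat \<bar>s\<bar>"
    by (rule cdist_cases)
  \<comment> \<open>At \<open>s = int k\<close> the next representative is \<open>- int k\<close>,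
    not \<open>int k + 1\<close>. This is where two adjacent positions are equidistant from
    \<open>j\<close>.\<close>
  have 2: "cdist k (i + 1) j = (if s = int k then k else nat \<bar>s + 1\<bar>)"
  proof (cases "s = int k")
    case True
    have "cdist k (i + 1) j = nat \<bar>- int k\<bar>"
      by (rule cdist_eqI[where q = "q + 1"]) (use * True in \<open>simp_all add: algebra_simps\<close>)
    then show ?thesis using True by simp
  next
    case False
    have "cdist k (i + 1) j = nat \<bar>s + 1\<bar>"
      by (rule cdist_eqI[where q = q]) (use * False in simp_all)
    then show ?thesis using False by simp
  qed
  show "cdist k (i + 1) j \<le> Suc (cdist k i j)" "cdist k i j \<le> Suc (cdist k (i + 1) j)"
    unfolding 2 *(3) using *(2) by (auto simp: nat_le_iff)
qed

lemma cdist_decrease: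
  assumes "cdist k i j \<noteq> 0"
  obtains e where "e = 1 \<or> e = -1" "cdist k i j = Suc (cdist k (i + e) j)"
proof -
  obtain s q where *: "i = j + s + (2 * int k + 1) * q" "\<bar>s\<bar> \<le> int k" "cdist k i j = nat \<bar>s\<bar>"
    by (rule cdist_cases)
  define e :: int where "e = (if s > 0 then -1 else 1)"
  have s: "s \<noteq> 0" using assms * by auto
  have "cdist k (i + e) j = nat \<bar>s + e\<bar>"
    by (rule cdist_eqI[where q = q]) (use * s in \<open>auto simp: e_def\<close>)
  then have "cdist k i j = Suc (cdist k (i + e) j)" unfolding *(3) using s by (auto simp: e_def)
  then show thesis using that[of e] by (auto simp: e_def)
qed

text \<open>
  Antipodal points are joined by arcs of lengths \<open>k\<close> and \<open>k + 1\<close>, one of which is even and the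
  other odd.
\<close>

lemma cdist_midpoints:
  assumes ab: "cdist k a b = k" and "k \<ge> 1"
  shows "\<exists>j. cdist k j a = cdist k j b" "\<exists>j. cdist k j a = Suc (cdist k j b)"
proof -
  obtain s q where *: "a = b + s + (2 * int k + 1) * q" "\<bar>s\<bar> \<le> int k" "cdist k a b = nat \<bar>s\<bar>"
    by (rule cdist_cases)
  then have "s = int k \<or> s = - int k" using ab by auto
  then obtain e :: int where e: "e = 1 \<or> e = -1" "s = e * int k"
    by (metis mult_1 mult_minus_left)
  \<comment> \<open>The sign \<open>e\<close> points from \<open>b\<close> to \<open>a\<close> along
    the arc of length \<open>k\<close>. \<open>near\<close> and \<open>far\<close> measure from the
    point \<open>t\<close> steps along this arc, \<open>near'\<close> and \<open>far'\<close> from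
    the point \<open>t\<close> steps along the other arc, of length \<open>k + 1\<close>. The parity
    of \<open>k\<close> then decides which arc supplies the witness.\<close>
  have near: "cdist k (b + e * t) b = nat \<bar>t\<bar>" if "\<bar>t\<bar> \<le> int k" for t
    using cdist_eq_abs[of "b + e * t" b k] that e by (auto simp: abs_mult)
  have near': "cdist k (b - e * t) b = nat \<bar>t\<bar>" if "\<bar>t\<bar> \<le> int k" for t
    using near[of "- t"] that by simp
  have far: "cdist k (b + e * t) a = nat \<bar>t - int k\<bar>" if "\<bar>t - int k\<bar> \<le> int k" for t
  proof -
    have "cdist k (b + e * t) a = nat \<bar>e * (t - int k)\<bar>"
      by (rule cdist_eqI[where q = "- q"]) (use *(1) e that in \<open>auto simp: algebra_simps\<close>)
    then show ?thesis using e by (auto simp: abs_mult)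
  qed
  have far': "cdist k (b - e * t) a = nat \<bar>int k + 1 - t\<bar>" if "\<bar>int k + 1 - t\<bar> \<le> int k" for t
  proof -
    have "cdist k (b - e * t) a = nat \<bar>e * (int k + 1 - t)\<bar>"
      by (rule cdist_eqI[where q = "- q - e"]) (use *(1) e that in \<open>auto simp: algebra_simps\<close>)
    then show ?thesis using e by (auto simp: abs_mult)
  qed
  show "\<exists>j. cdist k j a = cdist k j b"
  proof (cases "even k")
    case True
    then obtain h where "k = 2 * h" by auto
    then show ?thesis using near[of "int h"] far[of "int h"] by (intro exI[of _ "b + e * int h"]) simp
  next
    case False
    then obtain h where "k = 2 * h + 1" by (auto elim: oddE)
    then show ?thesis using near'[of "int (h + 1)"] far'[of "int (h + 1)"]
      by (intro exI[of _ "b - e * int (h + 1)"]) simp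
  qed
  show "\<exists>j. cdist k j a = Suc (cdist k j b)"
  proof (cases "even k")
    case True
    then obtain h where "k = 2 * h" "h \<ge> 1" using \<open>k \<ge> 1\<close> by auto
    then show ?thesis using near'[of "int h"] far'[of "int h"]
      by (intro exI[of _ "b - e * int h"]) simp
  next
    case False
    then obtain h where "k = 2 * h + 1" by (auto elim: oddE)
    then show ?thesis using near[of "int h"] far[of "int h"]
      by (intro exI[of _ "b + e * int h"]) simp
  qed
qed

section \<open>Colourings without rainbow progressions over a geodesic metric\<close>

locale geodesic_metric =
  fixes V :: "'a set" and d :: "'a \<Rightarrow> 'a \<Rightarrow> nat"
  assumes d_self: "x \<in> V \<Longrightarrow> d x x = 0"
    and d_sym: "x \<in> V \<Longrightarrow> y \<in> V \<Longrightarrow> d x y = d y x"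
    and d_triangle: "x \<in> V \<Longrightarrow> y \<in> V \<Longrightarrow> z \<in> V \<Longrightarrow> d x z \<le> d x y + d y z"
    and d_step: "x \<in> V \<Longrightarrow> z \<in> V \<Longrightarrow> x \<noteq> z \<Longrightarrow> \<exists>w\<in>V. d x w = 1 \<and> d x z = Suc (d w z)"
begin

lemma adjacent_differing:
  assumes "x \<in> V" "z \<in> V" "f x \<noteq> f z"
  shows "\<exists>u\<in>V. \<exists>v\<in>V. d u v = 1 \<and> f u \<noteq> f v"
  using assms
proof (induction "d x z" arbitrary: x rule: less_induct)
  case less
  then have "x \<noteq> z" by auto
  then obtain w where w: "w \<in> V" "d x w = 1" "d x z = Suc (d w z)"
    using d_step less.prems by blast
  show ?case
  proof (cases "f x = f w")
    case True
    then show ?thesis using less.hyps[of w] w less.prems by auto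
  qed (use w less.prems in blast)
qed

end

text \<open>\<open>F x i\<close> is the colour at position \<open>i\<close> of column
  \<open>x\<close>. In \<open>no_rainbow\<close> the centre is \<open>(y, j)\<close> and the ends
  are \<open>(x, i)\<close> and \<open>(z, l)\<close>; instantiations list the variables as
  \<open>x y z j i l\<close>. Coinciding points share a colour, so the three points need not be
  assumed distinct.\<close>

locale rainbow_free = geodesic_metric V d for V :: "'a set" and d :: "'a \<Rightarrow> 'a \<Rightarrow> nat" +
  fixes F :: "'a \<Rightarrow> int \<Rightarrow> 'c" and k :: nat
  assumes k_pos: "k \<ge> 1"
    and periodic: "F x (i mod (2 * int k + 1)) = F x i"
    and no_rainbow: "\<lbrakk>x \<in> V; y \<in> V; z \<in> V; d y x + cdist k j i = d y z + cdist k j l\<rbrakk>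
      \<Longrightarrow> F x i = F y j \<or> F z l = F y j \<or> F x i = F z l"
begin

text \<open>Both ends of the rung at \<open>j\<close> are equidistant from the two reflected points.
  If those had different colours, the point at \<open>j - e * int t\<close> would need the colour of
  either end of the rung, but these differ.\<close>

lemma rung_reflection:
  assumes uv: "u \<in> V" "v \<in> V" "d u v = 1" and e: "e = 1 \<or> e = -1" and t: "t \<le> k"
    and ne: "F u j \<noteq> F v j" and c: "F u (j + e * int t) \<notin> {F u j, F v j}"
  shows "F u (j - e * int t) = F u (j + e * int t)"
proof -
  have cd: "cdist k j (j + e * int t) = t" "cdist k j (j - e * int t) = t"
    using t e by (auto simp: cdist_eq_abs)
  show ?thesis
    using no_rainbow[of u u u j "j + e * int t" "j - e * int t"]
      no_rainbow[of u v u j "j + e * int t" "j - e * int t"] uv cd c ne by auto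
qed

text \<open>
  If a third colour occurs at offset \<open>t \<ge> 2\<close> from a bichromatic rung, then it occurs at \<open>-t\<close> as
  well, and centring progressions there forces a neighbouring rung to be bichromatic with the same
  two colours, at smaller offset; at the antipode \<open>t = k\<close> it yields a contradiction directly.
\<close>

lemma bichromatic_rung:
  assumes "t \<le> k" "u \<in> V" "v \<in> V" "d u v = 1" "e = 1 \<or> e = -1" "F u j \<noteq> F v j"
  shows "F u (j + e * int t) \<in> {F u j, F v j}"
  using assms
proof (induction t arbitrary: j)
  case 0
  then show ?case by simp
next
  case (Suc t)
  note uv = Suc.prems(2-4) and e = Suc.prems(5) and ne = Suc.prems(6)
  have vu: "d v u = 1" using uv d_sym by auto
  have duu: "d u u = 0" "d v v = 0" using uv d_self by auto
  \<comment> \<open>Each end of the rung is at distance 1 both from the other end and from the next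
    position in its own column, so it is the centre of a progression.\<close>
  have one: "F u (j + e') \<in> {F u j, F v j}" "F v (j + e') \<in> {F u j, F v j}" if "e' = 1 \<or> e' = -1" for e'
  proof -
    have cd: "cdist k j (j + e') = 1" using that k_pos by (auto simp: cdist_eq_abs)
    show "F u (j + e') \<in> {F u j, F v j}" "F v (j + e') \<in> {F u j, F v j}"
      using no_rainbow[of v u u j j "j + e'"] no_rainbow[of u v v j j "j + e'"] uv vu duu cd ne
      by auto
  qed
  let ?t = "int (Suc t)"
  show ?case
  proof (rule ccontr)
    assume c: "F u (j + e * ?t) \<notin> {F u j, F v j}"
    have c': "F u (j - e * ?t) = F u (j + e * ?t)"
      by (rule rung_reflection) (use uv e ne c Suc.prems in auto)
    have t1: "t \<ge> 1" using c one(1)[OF e] by (cases t) auto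
    have cd: "cdist k (j + e * ?t) j = Suc t" "cdist k (j + e * ?t) (j + e) = t"
      "cdist k (j - e * ?t) j = Suc t" "cdist k (j - e * ?t) (j - e) = t"
      using e Suc.prems(1) by (auto simp: cdist_eq_abs)
    \<comment> \<open>Seen from the third colour at \<open>(u, j + e * ?t)\<close>, the step from
      \<open>u\<close> to \<open>v\<close> costs exactly what moving from \<open>j\<close> to
      \<open>j + e\<close> saves. The same holds for \<open>v2\<close> on the reflected
      side.\<close>
    have v1: "F v (j + e) = F u j"
      using no_rainbow[of u u v "j + e * ?t" j "j + e"] uv duu cd one(2)[of e] e c by auto
    have v2: "F v (j - e) = F u j"
      using no_rainbow[of u u v "j - e * ?t" j "j - e"] uv duu cd one(2)[of "- e"] e c c' by auto
    show False
    proof (cases "Suc t < k")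
      case True
      \<comment> \<open>Centring at the reflected point shows that the rung at \<open>j + e\<close>
        has the two colours swapped. The third colour lies at offset \<open>t\<close> from it,
        against the induction hypothesis.\<close>
      have "cdist k (j - e * ?t) (j + e) = Suc (Suc t)"
        using e True by (auto simp: cdist_eq_abs)
      then have u1: "F u (j + e) = F v j"
        using no_rainbow[of v u u "j - e * ?t" j "j + e"] uv duu cd one(1)[of e] e c c' by auto
      have "F u (j + e + e * int t) \<in> {F u (j + e), F v (j + e)}"
        by (rule Suc.IH) (use Suc.prems u1 v1 in auto)
      then show False using c u1 v1 by (simp add: algebra_simps)
    next
      case False
      then have tk: "Suc t = k" using Suc.prems by simp
      \<comment> \<open>The third colour is now equidistant from positions \<open>j\<close> and
        \<open>j - e\<close>, whose points in column \<open>v\<close> have the two different colours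
        of the rung.\<close>
      have "cdist k (j - e + e * (int k + 1)) (j - e) = k"
        by (rule cdist_offset_antipode) (use e in auto)
      then have "cdist k (j + e * ?t) (j - e) = k" unfolding tk by (simp add: algebra_simps)
      then show False
        using no_rainbow[of v u v "j + e * ?t" j "j - e"] uv vu cd v2 c ne tk by auto
    qed
  qed
qed

text \<open>Every position has offset at most \<open>k\<close> from a given one, so a single
  bichromatic rung restricts both columns to its colours. Without such a rung the columns agree; a
  change of colour between \<open>j\<close> and \<open>j + 1\<close>, seen from a third colour at
  \<open>l\<close>, then gives a rainbow progression, taking one end from column \<open>v\<close> if
  the two distances differ by one.\<close>

lemma edge_at_most_two_colors:
  assumes uv: "u \<in> V" "v \<in> V" "d u v = 1"
    and abc: "{\<alpha>, \<beta>, \<gamma>} \<subseteq> range (F u) \<union> range (F v)"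
  shows "\<alpha> = \<beta> \<or> \<beta> = \<gamma> \<or> \<alpha> = \<gamma>"
proof (cases "\<exists>j. F u j \<noteq> F v j")
  case True
  then obtain j where j: "F u j \<noteq> F v j" by blast
  have vu: "d v u = 1" using uv d_sym by auto
  have "F u l \<in> {F u j, F v j} \<and> F v l \<in> {F u j, F v j}" for l
  proof -
    obtain s q where *: "l = j + s + (2 * int k + 1) * q" "\<bar>s\<bar> \<le> int k"
      by (rule cdist_representative)
    have l: "F x l = F x (j + s)" for x
      using periodic[of x l] periodic[of x "j + s"] unfolding *(1) by (metis mod_mult_self2)
    define e :: int where "e = (if s \<ge> 0 then 1 else -1)"
    have s: "s = e * int (nat \<bar>s\<bar>)" by (simp add: e_def)
    have "F u (j + e * int (nat \<bar>s\<bar>)) \<in> {F u j, F v j}"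
      by (rule bichromatic_rung) (use uv j * in \<open>auto simp: e_def\<close>)
    moreover have "F v (j + e * int (nat \<bar>s\<bar>)) \<in> {F v j, F u j}"
      by (rule bichromatic_rung) (use uv vu j * in \<open>auto simp: e_def\<close>)
    ultimately show ?thesis unfolding l using s by auto
  qed
  then have "range (F u) \<union> range (F v) \<subseteq> {F u j, F v j}" by blast
  with abc have "{\<alpha>, \<beta>, \<gamma>} \<subseteq> {F u j, F v j}" by (rule order_trans)
  then show ?thesis by auto
next
  case False
  then have eq: "F v = F u" by auto
  show ?thesis
  proof (rule ccontr)
    assume distinct: "\<not> ?thesis"
    obtain i1 i2 i3 where i: "F u i1 = \<alpha>" "F u i2 = \<beta>" "F u i3 = \<gamma>"
      using abc eq by auto
    have "\<exists>j. F u j \<noteq> F u (j + 1)"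
    proof (rule ccontr)
      assume "\<not> ?thesis"
      then have step: "F u (j + 1) = F u j" for j by metis
      have "F u x = F u 0" for x
        by (induction x rule: int_induct[where k = 0]) (use step step[of "_ - 1"] in auto)
      then show False using i distinct by metis
    qed
    then obtain j where j: "F u j \<noteq> F u (j + 1)" by blast
    obtain l where l: "F u l \<noteq> F u j" "F u l \<noteq> F u (j + 1)"
      using i distinct by metis
    have "cdist k l j = cdist k l (j + 1) \<or> cdist k l j = Suc (cdist k l (j + 1))
        \<or> cdist k l (j + 1) = Suc (cdist k l j)"
      using cdist_Suc_le[of k j l] cdist_commute[of k] by (metis le_SucE le_antisym)
    then show False
      using no_rainbow[of u u u l j "j + 1"] no_rainbow[of u u v l j "j + 1"]
        no_rainbow[of v u u l j "j + 1"] uv l j d_self[of u] eq by auto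
  qed
qed

text \<open>The distances from \<open>z\<close> to \<open>u\<close> and \<open>v\<close> differ by
  at most one, and a step around the cycle makes up the difference without changing the colour, as
  both columns are constant.\<close>

lemma constant_edge:
  assumes uv: "u \<in> V" "v \<in> V" "d u v = 1" and z: "z \<in> V"
    and p: "\<And>i. F u i = p" and q: "\<And>i. F v i = q" and "p \<noteq> q"
  shows "F z b \<in> {p, q}"
proof -
  have vu: "d v u = 1" using uv d_sym by auto
  have "d z u \<le> d z v + 1" "d z v \<le> d z u + 1"
    using d_triangle[of z v u] d_triangle[of z u v] uv vu z by auto
  then have "d z u = d z v \<or> d z u = Suc (d z v) \<or> d z v = Suc (d z u)" by linarith
  moreover have "cdist k b (b + 1) = 1" using k_pos by (simp add: cdist_eq_abs)
  ultimately show ?thesis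
    using no_rainbow[of u z v b b b] no_rainbow[of u z v b b "b + 1"]
      no_rainbow[of u z v b "b + 1" b] uv z p q \<open>p \<noteq> q\<close> by auto
qed

text \<open>Induction on \<open>d u z\<close> takes the place of choosing a closest pair of
  columns.\<close>

lemma third_color_from_two_colored:
  assumes "u \<in> V" "z \<in> V" "F u a1 \<noteq> F u a2" "F z b \<notin> range (F u)"
  shows False
  using assms
proof (induction "d u z" arbitrary: u z a1 a2 b rule: less_induct)
  case less
  note u = less.prems(1) and z = less.prems(2)
  define m where "m = d u z"
  have ub: "F u i \<noteq> F z b" for i using less.prems(4) by (metis rangeI)
  have "u \<noteq> z" using less.prems by auto
  then obtain w1 where w1: "w1 \<in> V" "d u w1 = 1" "m = Suc (d w1 z)"
    using d_step u z m_def by blast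
  have "m \<noteq> 1"
  proof
    assume "m = 1"
    then have "d u z = 1" using m_def by simp
    then show False
      using edge_at_most_two_colors[of u z "F u a1" "F u a2" "F z b"] u z less.prems(3) ub by auto
  qed
  then have m2: "m \<ge> 2" using w1 by simp
  \<comment> \<open>If \<open>w\<close> contained the colour \<open>F z b\<close>, then
    \<open>u\<close> and \<open>w\<close> would be a closer pair; if it avoided that colour but had
    two colours, \<open>w\<close> and \<open>z\<close> would be one.\<close>
  have interior: "F w i = F w 0 \<and> F w i \<noteq> F z b"
    if w: "w \<in> V" "d u w < m" "d w z < m" for w i
  proof -
    have nb: "F w l \<noteq> F z b" for l
    proof
      assume "F w l = F z b"
      then have "F w l \<notin> range (F u)" using less.prems(4) by simp
      then show False using less.hyps[of u w a1 a2 l] u w less.prems(3) by (simp add: m_def)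
    qed
    then have "F z b \<notin> range (F w)" by (metis rangeE)
    then have "F w i = F w 0" using less.hyps[of w z i 0 b] z w by (auto simp: m_def)
    then show ?thesis using nb by blast
  qed
  define p where "p = F w1 0"
  have p_w1: "F w1 i = p" for i using interior[of w1 i] w1 m2 by (simp add: p_def)
  obtain a where a: "F u a \<noteq> p" using less.prems(3) by metis
  have pb: "p \<noteq> F z b" using interior[of w1 0] w1 m2 by (simp add: p_def)
  \<comment> \<open>The colour \<open>p\<close> spreads along a geodesic: two adjacent constant
    columns of different colours, both different from \<open>F z b\<close>, would contradict
    \<open>constant_edge\<close>.\<close>
  have geodesic: "\<exists>w\<in>V. d u w = Suc i \<and> d w z = m - Suc i \<and> (\<forall>l. F w l = p)" if "Suc i < m" for i
    using that
  proof (induction i)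
    case 0
    then show ?case using w1 p_w1 by auto
  next
    case (Suc i)
    then obtain w where w: "w \<in> V" "d u w = Suc i" "d w z = m - Suc i" "\<forall>l. F w l = p" by auto
    then have "w \<noteq> z" using Suc.prems d_self[of z] z by auto
    then obtain w' where w': "w' \<in> V" "d w w' = 1" "d w z = Suc (d w' z)"
      using d_step w z by blast
    have dist: "d w' z = m - Suc (Suc i)" "d u w' = Suc (Suc i)"
      using w w' d_triangle[of u w w'] d_triangle[of u w' z] u z Suc.prems unfolding m_def by auto
    have mono: "F w' l = F w' 0 \<and> F w' l \<noteq> F z b" for l
      by (rule interior) (use w' dist Suc.prems in auto)
    have "F w' 0 = p"
      using constant_edge[of w w' z p "F w' 0" b] w w' z mono pb by (cases "F w' 0 = p") auto
    then have "\<forall>l. F w' l = p" using mono by metis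
    then show ?case using w' dist by blast
  qed
  show False
  proof (cases "cdist k a b < k")
    case True
    \<comment> \<open>Centre \<open>(z, b)\<close>: column \<open>w1\<close> is one nearer to
      \<open>z\<close> than \<open>u\<close> is, and there is room for one more step around the
      cycle to compensate.\<close>
    have "cdist k b (b + int (Suc (cdist k a b))) = Suc (cdist k a b)"
      using True by (simp add: cdist_eq_abs)
    moreover have "d z u = m" "d z w1 = m - 1"
      using d_sym u z w1 m_def by auto
    ultimately show False
      using no_rainbow[of u z w1 b a "b + int (Suc (cdist k a b))"] u z w1 p_w1 a ub pb m2
        cdist_commute[of k a b] by auto
  next
    case False
    then have cd: "cdist k a b = k" using cdist_le[of k a b] by simp
    \<comment> \<open>\<open>a\<close> and \<open>b\<close> are antipodal, so the centre goes into a
      column halfway. For odd \<open>m\<close> this column is one nearer to \<open>u\<close> than to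
      \<open>z\<close>, which the second part of \<open>cdist_midpoints\<close> balances.\<close>
    have "Suc (m div 2 - 1) < m" using m2 by auto
    then obtain w where w: "w \<in> V" "d u w = Suc (m div 2 - 1)" "d w z = m - Suc (m div 2 - 1)"
      "\<forall>l. F w l = p"
      using geodesic by blast
    have wu: "d w u = m div 2" "d w z = m - m div 2" using w d_sym u m2 by auto
    obtain j where "d w u + cdist k j a = d w z + cdist k j b"
    proof (cases "even m")
      case True
      then have "m - m div 2 = m div 2" by auto
      then show ?thesis using cdist_midpoints(1)[OF cd k_pos] wu that by auto
    next
      case odd: False
      then have "m - m div 2 = Suc (m div 2)" by (auto elim: oddE)
      then show ?thesis using cdist_midpoints(2)[OF cd k_pos] wu that by auto
    qed
    then show False using no_rainbow[of u w z j a b] u w z a ub pb by auto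
  qed
qed

text \<open>A column with two colours would contain all three, and so would an edge at that column,
  which exists because \<open>V\<close> has two points. Hence all columns are constant, and two
  adjacent ones of different colours admit no third colour.\<close>

lemma at_most_two_colors:
  assumes x: "x1 \<in> V" "x2 \<in> V" "x3 \<in> V" and y: "y1 \<in> V" "y2 \<in> V" "y1 \<noteq> y2"
  shows "F x1 i1 = F x2 i2 \<or> F x2 i2 = F x3 i3 \<or> F x1 i1 = F x3 i3"
proof (rule ccontr)
  assume ne: "\<not> ?thesis"
  have mono: "F u a = F u 0" if u: "u \<in> V" for u a
  proof (rule ccontr)
    assume two: "F u a \<noteq> F u 0"
    have "F x1 i1 \<in> range (F u)" "F x2 i2 \<in> range (F u)" "F x3 i3 \<in> range (F u)"
      using third_color_from_two_colored[OF u _ two] x by blast+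
    moreover obtain y where "y \<in> V" "u \<noteq> y" using y by metis
    then obtain v where "v \<in> V" "d u v = 1" using d_step u by blast
    ultimately show False
      using edge_at_most_two_colors[of u v "F x1 i1" "F x2 i2" "F x3 i3"] u ne by auto
  qed
  have "F x1 0 \<noteq> F x2 0" using ne mono[OF x(1), of i1] mono[OF x(2), of i2] by simp
  then obtain u v where uv: "u \<in> V" "v \<in> V" "d u v = 1" "F u 0 \<noteq> F v 0"
    using adjacent_differing[of x1 x2 "\<lambda>x. F x 0"] x by auto
  have "F z i \<in> {F u 0, F v 0}" if "z \<in> V" for z i
    by (rule constant_edge[OF uv(1-3) that mono[OF uv(1)] mono[OF uv(2)] uv(4)])
  then have "F x1 i1 \<in> {F u 0, F v 0}" "F x2 i2 \<in> {F u 0, F v 0}" "F x3 i3 \<in> {F u 0, F v 0}"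
    using x by auto
  then show False using ne by auto
qed

end

section \<open>Walk distances in a connected graph\<close>

text \<open>Natural numbers keep \<open>ereal\<close> out of the combinatorial argument. The value
  is unspecified when \<open>v\<close> cannot be reached from \<open>u\<close>.\<close>

definition walk_dist :: "'a rel \<Rightarrow> 'a \<Rightarrow> 'a \<Rightarrow> nat" where
  "walk_dist R u v = (LEAST n. (u, v) \<in> R ^^ n)"

lemma walk_dist_relpow: "(u, v) \<in> R\<^sup>* \<Longrightarrow> (u, v) \<in> R ^^ walk_dist R u v"
  unfolding walk_dist_def by (metis LeastI rtrancl_imp_relpow)

lemma walk_dist_le: "(u, v) \<in> R ^^ n \<Longrightarrow> walk_dist R u v \<le> n"
  unfolding walk_dist_def by (rule Least_le)

lemma walk_dist_self [simp]: "walk_dist R u u = 0"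
  using walk_dist_le[of u u 0 R] by simp

lemma walk_dist_triangle:
  "(u, v) \<in> R\<^sup>* \<Longrightarrow> (v, w) \<in> R\<^sup>* \<Longrightarrow> walk_dist R u w \<le> walk_dist R u v + walk_dist R v w"
  by (rule walk_dist_le, rule relpow_trans) (rule walk_dist_relpow, assumption)+

lemma walk_dist_arc:
  assumes "(u, v) \<in> R" "(v, w) \<in> R\<^sup>*"
  shows "walk_dist R u w \<le> Suc (walk_dist R v w)"
  by (rule walk_dist_le, rule relpow_Suc_I2[OF assms(1) walk_dist_relpow[OF assms(2)]])

lemma walk_dist_decrease:
  assumes "(u, w) \<in> R\<^sup>*" "u \<noteq> w"
  shows "\<exists>v. (u, v) \<in> R \<and> walk_dist R u w = Suc (walk_dist R v w)"
proof -
  have "walk_dist R u w \<noteq> 0" using walk_dist_relpow[OF assms(1)] assms(2) by (auto intro: ccontr)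
  then obtain n where n: "walk_dist R u w = Suc n" by (cases "walk_dist R u w") auto
  then obtain v where v: "(u, v) \<in> R" "(v, w) \<in> R ^^ n"
    using walk_dist_relpow[OF assms(1)] relpow_Suc_D2 by metis
  have "walk_dist R v w \<le> n" using v walk_dist_le by metis
  moreover have "walk_dist R u w \<le> Suc (walk_dist R v w)"
    using v walk_dist_arc relpow_imp_rtrancl by metis
  ultimately show ?thesis using n v by auto
qed

lemma walk_dist_commute:
  assumes "sym R"
  shows "walk_dist R u v = walk_dist R v u"
proof -
  have "(v, u) \<in> R ^^ n" if "(u, v) \<in> R ^^ n" for u v n
    using that
  proof (induction n arbitrary: v)
    case (Suc n)
    then obtain w where "(u, w) \<in> R ^^ n" "(w, v) \<in> R" by auto
    then show ?case using Suc.IH[of w] assms by (meson relpow_Suc_I2 symD)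
  qed auto
  then show ?thesis unfolding walk_dist_def by metis
qed

lemma connected_rtrancl:
  assumes "pair_graph G" "Digraph_Component.connected (with_proj G)" "u \<in> pverts G" "v \<in> pverts G"
  shows "(u, v) \<in> (parcs G)\<^sup>*"
proof -
  interpret pair_graph G by fact
  have "u \<rightarrow>\<^sup>*\<^bsub>with_proj (mk_symmetric (with_proj G))\<^esub> v"
    using assms by (simp add: connected_def strongly_connected_def mk_symmetric_def)
  then have "u \<rightarrow>\<^sup>*\<^bsub>with_proj G\<^esub> v"
    using reachable_mk_symmetric_eq[OF sym_arcs] by simp
  then show ?thesis using reachable_rtranclI by fastforce
qed

lemma geodesic_metric_walk_dist:
  assumes G: "pair_graph G" "Digraph_Component.connected (with_proj G)"
  shows "geodesic_metric (pverts G) (walk_dist (parcs G))"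
proof -
  interpret pair_graph G by fact
  note reach = connected_rtrancl[OF G]
  have "sym (parcs G)" using sym_arcs by (simp add: symmetric_def)
  show ?thesis
  proof
    fix x z assume x: "x \<in> pverts G" and z: "z \<in> pverts G" and "x \<noteq> z"
    then obtain w where w: "(x, w) \<in> parcs G" "walk_dist (parcs G) x z = Suc (walk_dist (parcs G) w z)"
      using walk_dist_decrease[OF reach] by metis
    then have "w \<in> pverts G" by (blast dest: wellformed')
    moreover have "walk_dist (parcs G) x w \<le> 1"
      using w by (intro walk_dist_le) simp
    moreover have "walk_dist (parcs G) x z \<le> walk_dist (parcs G) x w + walk_dist (parcs G) w z"
      using x z calculation(1) by (intro walk_dist_triangle reach)
    ultimately show "\<exists>w\<in>pverts G. walk_dist (parcs G) x w = 1
        \<and> walk_dist (parcs G) x z = Suc (walk_dist (parcs G) w z)"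
      using w by (intro bexI[of _ w]) auto
  qed (auto intro: walk_dist_triangle reach walk_dist_commute \<open>sym (parcs G)\<close>)
qed

section \<open>Distances in the product with a cycle\<close>

text \<open>\<open>D\<close> acts as a potential: it drops by at most one per arc, which bounds
  every walk to \<open>w\<close> from below, and descending greedily gives a walk attaining the
  bound.\<close>

lemma gdist_eqI:
  fixes D :: "'a \<Rightarrow> nat"
  assumes G: "pair_graph G" and u: "u \<in> pverts G" and w: "w \<in> pverts G" "D w = 0"
    and arc: "\<And>u v. (u, v) \<in> parcs G \<Longrightarrow> D u \<le> Suc (D v)"
    and decrease: "\<And>u. u \<in> pverts G \<Longrightarrow> u \<noteq> w \<Longrightarrow> \<exists>v. (u, v) \<in> parcs G \<and> D u = Suc (D v)"
  shows "gdist G u w = ereal (real (D u))"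
proof -
  interpret pair_graph G by fact
  have "\<exists>p. awalk u p w \<and> length p = D u"
    using u
  proof (induction "D u" arbitrary: u rule: less_induct)
    case less
    show ?case
    proof (cases "u = w")
      case True
      then show ?thesis using less.prems w by (intro exI[of _ "[]"]) (simp add: awalk_Nil_iff)
    next
      case False
      then obtain v where v: "(u, v) \<in> parcs G" "D u = Suc (D v)"
        using decrease less.prems by metis
      then obtain p where "awalk v p w" "length p = D v"
        using less.hyps[of v] wellformed' by auto
      then show ?thesis using v by (intro exI[of _ "(u, v) # p"]) (simp add: awalk_Cons_iff)
    qed
  qed
  then obtain p where p: "awalk u p w" "length p = D u" by blast
  have lower: "D u \<le> length q" if "awalk u q w" for u q
    using that
  proof (induction q arbitrary: u)
    case Nil
    then show ?case using w by (simp add: awalk_Nil_iff)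
  next
    case (Cons e q)
    then have "(u, snd e) \<in> parcs G" "D (snd e) \<le> length q"
      by (auto simp: awalk_Cons_iff)
    then show ?case using arc by fastforce
  qed
  show ?thesis
    unfolding gdist_eq[OF G]
  proof (rule antisym)
    show "(INF p\<in>{p. awalk u p w}. ereal (real (length p))) \<le> ereal (real (D u))"
      using p by (intro INF_lower2[of p]) auto
    show "ereal (real (D u)) \<le> (INF p\<in>{p. awalk u p w}. ereal (real (length p)))"
      using lower by (intro INF_greatest) auto
  qed
qed

lemma cycle_graph_arc_cdist:
  assumes "(i, i') \<in> parcs (cycle_graph (2 * k + 1))"
  shows "cdist k (int i) j \<le> Suc (cdist k (int i') j)"
proof -
  have eq: "cdist k (int (Suc m mod (2 * k + 1))) j = cdist k (int m + 1) j" for m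
    by (rule cdist_cong) (simp_all add: zmod_int add.commute)
  show ?thesis using assms cdist_Suc_le[of k _ j] eq by (auto simp: cycle_graph_def)
qed

lemma cycle_graph_decrease_cdist:
  assumes i: "i < 2 * k + 1" and j: "j < 2 * k + 1" and "i \<noteq> j"
  shows "\<exists>i'. (i, i') \<in> parcs (cycle_graph (2 * k + 1))
    \<and> cdist k (int i) (int j) = Suc (cdist k (int i') (int j))"
proof -
  let ?n = "2 * int k + 1"
  have "cdist k (int i) (int j) \<noteq> 0"
  proof
    assume 0: "cdist k (int i) (int j) = 0"
    obtain s q where "int i = int j + s + ?n * q" "cdist k (int i) (int j) = nat \<bar>s\<bar>"
      by (rule cdist_cases)
    then have "int i mod ?n = int j mod ?n" using 0 by simp
    then show False using i j \<open>i \<noteq> j\<close> by simp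
  qed
  then obtain e where e: "e = 1 \<or> e = -1" "cdist k (int i) (int j) = Suc (cdist k (int i + e) (int j))"
    by (rule cdist_decrease)
  define i' where "i' = nat ((int i + e) mod ?n)"
  have i': "int i' = (int i + e) mod ?n" by (simp add: i'_def)
  then have "cdist k (int i') (int j) = cdist k (int i + e) (int j)"
    by (intro cdist_cong) simp_all
  moreover have "(i, i') \<in> parcs (cycle_graph (2 * k + 1))"
    using e(1)
  proof
    assume "e = 1"
    then have "int i' = int (Suc i mod (2 * k + 1))" using i' by (simp add: zmod_int add.commute)
    then have "i' = Suc i mod (2 * k + 1)" by (simp only: of_nat_eq_iff)
    then show ?thesis using i by (auto simp: cycle_graph_def)
  next
    assume "e = -1"
    then have "int (Suc i' mod (2 * k + 1)) = ((int i - 1) mod ?n + 1) mod ?n"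
      using i' by (simp add: zmod_int add.commute)
    also have "\<dots> = int i" using i by (simp add: mod_simps)
    finally have "i = Suc i' mod (2 * k + 1)" by (simp only: of_nat_eq_iff)
    moreover have "int i' < ?n" unfolding i' by (rule pos_mod_bound) simp
    ultimately show ?thesis by (auto simp: cycle_graph_def)
  qed
  ultimately show ?thesis using e(2) by auto
qed

text \<open>The sum of the two distances is the potential. An arc of the product changes only one
  summand, and the descent goes through \<open>G\<close> until column \<open>y\<close> is reached,
  then around the cycle.\<close>

lemma gdist_cart_prod_cycle:
  assumes k: "k \<ge> 1" and G: "pair_graph G" "Digraph_Component.connected (with_proj G)"
    and x: "x \<in> pverts G" "y \<in> pverts G" and i: "i < 2 * k + 1" "j < 2 * k + 1"
  shows "gdist (G \<box> cycle_graph (2 * k + 1)) (x, i) (y, j)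
    = ereal (real (walk_dist (parcs G) x y + cdist k (int i) (int j)))"
proof -
  interpret pair_graph G by fact
  let ?C = "cycle_graph (2 * k + 1)"
  let ?D = "\<lambda>(x, i). walk_dist (parcs G) x y + cdist k (int i) (int j)"
  note reach = connected_rtrancl[OF G]
  have verts: "pverts (G \<box> ?C) = pverts G \<times> {..<2 * k + 1}"
    by (simp add: cart_prod_def cycle_graph_def)
  have "gdist (G \<box> ?C) (x, i) (y, j) = ereal (real (?D (x, i)))"
  proof (rule gdist_eqI)
    show "pair_graph (G \<box> ?C)"
      using k G by (intro pair_graph_cart_prod pair_graph_cycle_graph) auto
    show "(x, i) \<in> pverts (G \<box> ?C)" "(y, j) \<in> pverts (G \<box> ?C)" using x i unfolding verts by auto
    show "?D (y, j) = 0" by simp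
  next
    fix a b assume "(a, b) \<in> parcs (G \<box> ?C)"
    then show "?D a \<le> Suc (?D b)"
      using cycle_graph_arc_cdist[of _ _ k "int j"]
        walk_dist_arc[OF _ reach[OF in_arcsD2 x(2)], of _ _]
      by (auto simp: cart_prod_def)
  next
    fix a assume a: "a \<in> pverts (G \<box> ?C)" "a \<noteq> (y, j)"
    obtain a1 a2 where [simp]: "a = (a1, a2)" by (cases a)
    have a12: "a1 \<in> pverts G" "a2 < 2 * k + 1" using a unfolding verts by auto
    show "\<exists>b. (a, b) \<in> parcs (G \<box> ?C) \<and> ?D a = Suc (?D b)"
    proof (cases "a1 = y")
      case True
      then have "a2 \<noteq> j" using a by simp
      then obtain b2 where "(a2, b2) \<in> parcs ?C"
          "cdist k (int a2) (int j) = Suc (cdist k (int b2) (int j))"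
        using cycle_graph_decrease_cdist[OF a12(2) i(2)] by blast
      then show ?thesis using a12 by (intro exI[of _ "(a1, b2)"]) (auto simp: cart_prod_def)
    next
      case False
      then obtain b1 where "(a1, b1) \<in> parcs G"
          "walk_dist (parcs G) a1 y = Suc (walk_dist (parcs G) b1 y)"
        using walk_dist_decrease[OF reach] a12 x by metis
      then show ?thesis using a12
        by (intro exI[of _ "(b1, a2)"]) (auto simp: cart_prod_def cycle_graph_def)
    qed
  qed
  then show ?thesis by simp
qed

section \<open>Exact colourings and the value of \<open>aw3\<close>\<close>

lemma exact_three_coloring_has_rainbow_3ap:
  assumes k: "k \<ge> 1" and G: "pair_graph G" "Digraph_Component.connected (with_proj G)"
    and card: "card (pverts G) \<ge> 2"
    and c: "exact_coloring (G \<box> cycle_graph (2 * k + 1)) 3 c"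
  shows "has_rainbow_3ap (G \<box> cycle_graph (2 * k + 1)) c"
proof (rule ccontr)
  let ?P = "G \<box> cycle_graph (2 * k + 1)"
  let ?n = "2 * int k + 1"
  let ?d = "walk_dist (parcs G)"
  assume none: "\<not> has_rainbow_3ap ?P c"
  define pos where "pos i = nat (i mod ?n)" for i
  \<comment> \<open>The periodic extension of the colouring to integer positions, as
    \<open>rainbow_free\<close> expects.\<close>
  define F where "F x i = c (x, pos i)" for x i
  have verts: "pverts ?P = pverts G \<times> {..<2 * k + 1}"
    by (simp add: cart_prod_def cycle_graph_def)
  have pos_int: "int (pos i) = i mod ?n" for i by (simp add: pos_def)
  have pos_less: "pos i < 2 * k + 1" for i
  proof -
    have "int (pos i) < ?n" unfolding pos_int by (rule pos_mod_bound) simp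
    then show ?thesis by linarith
  qed
  have dist: "gdist ?P (x, pos i) (y, pos j) = ereal (real (?d x y + cdist k i j))"
    if "x \<in> pverts G" "y \<in> pverts G" for x y i j
  proof -
    have "cdist k (int (pos i)) (int (pos j)) = cdist k i j"
      unfolding pos_int by (rule cdist_cong) simp_all
    then show ?thesis using gdist_cart_prod_cycle[OF k G that pos_less pos_less] by simp
  qed
  interpret geodesic_metric "pverts G" ?d
    by (rule geodesic_metric_walk_dist[OF G])
  interpret rainbow_free "pverts G" ?d F k
  proof
    show "k \<ge> 1" by fact
    show "F x (i mod ?n) = F x i" for x i by (simp add: F_def pos_def)
  next
    fix x y z i j l
    assume V: "x \<in> pverts G" "y \<in> pverts G" "z \<in> pverts G"
      and eq: "?d y x + cdist k j i = ?d y z + cdist k j l"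
    show "F x i = F y j \<or> F z l = F y j \<or> F x i = F z l"
    proof (rule ccontr)
      assume "\<not> ?thesis"
      then have ne: "c (x, pos i) \<noteq> c (y, pos j)" "c (z, pos l) \<noteq> c (y, pos j)"
          "c (x, pos i) \<noteq> c (z, pos l)"
        by (auto simp: F_def)
      let ?S = "{(x, pos i), (y, pos j), (z, pos l)}"
      have "gdist ?P (x, pos i) (y, pos j) = gdist ?P (y, pos j) (z, pos l)"
        using dist V eq d_sym[of x y] cdist_commute[of k i j] by simp
      moreover have "card ?S = 3" unfolding card_3_iff using ne by metis
      ultimately have "is_3ap ?P ?S"
        using V pos_less unfolding is_3ap_def verts by blast
      moreover have "rainbow c ?S" using ne by (auto simp: rainbow_def)
      ultimately show False using none by (auto simp: has_rainbow_3ap_def)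
    qed
  qed
  obtain T where "T \<subseteq> pverts G" "card T = 2"
    using obtain_subset_with_card_n[OF card] by blast
  then obtain y1 y2 where y: "y1 \<in> pverts G" "y2 \<in> pverts G" "y1 \<noteq> y2"
    by (auto simp: card_2_iff)
  have "\<exists>x\<in>pverts G. \<exists>i. F x i = r" if "r \<in> {1..3}" for r
  proof -
    have "r \<in> c ` (pverts G \<times> {..<2 * k + 1})"
      using c that unfolding exact_coloring_def verts by blast
    then obtain x m where "x \<in> pverts G" "m < 2 * k + 1" "c (x, m) = r" by auto
    then show ?thesis by (intro bexI[of _ x] exI[of _ "int m"]) (auto simp: F_def pos_def)
  qed
  from this[of 1] this[of 2] this[of 3] obtain x1 i1 x2 i2 x3 i3 where
    "x1 \<in> pverts G" "x2 \<in> pverts G" "x3 \<in> pverts G" "F x1 i1 = 1" "F x2 i2 = 2" "F x3 i3 = 3"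
    by auto
  then show False using at_most_two_colors[of x1 x2 x3 y1 y2 i1 i2 i3] y by auto
qed

text \<open>Without exact colourings in 1 and 2 colours, these values of \<open>r\<close> would
  satisfy the condition in \<open>aw3\<close> vacuously. The colouring in 3 colours selects the
  first branch of its definition.\<close>

lemma exact_coloring_exists:
  assumes "distinct [u, v, w]" "{u, v, w} \<subseteq> pverts G"
  shows "\<exists>c. exact_coloring G 1 c" "\<exists>c. exact_coloring G 2 c" "\<exists>c. exact_coloring G 3 c"
proof -
  show "\<exists>c. exact_coloring G 1 c"
    by (rule exI[of _ "\<lambda>_. 1"]) (use assms in \<open>auto simp: exact_coloring_def\<close>)
  have "(\<lambda>a. if a = u then 1 else 2) ` pverts G = {1, 2 :: nat}"
    using assms by (auto simp: image_iff)
  moreover have "{1, 2} = {1..2 :: nat}" by auto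
  ultimately show "\<exists>c. exact_coloring G 2 c" unfolding exact_coloring_def by metis
  have "(\<lambda>a. if a = u then 1 else if a = v then 2 else 3) ` pverts G = {1, 2, 3 :: nat}"
    using assms by (auto simp: image_iff)
  moreover have "{1, 2, 3} = {1..3 :: nat}" by auto
  ultimately show "\<exists>c. exact_coloring G 3 c" unfolding exact_coloring_def by metis
qed

lemma no_rainbow_3ap_few_colors:
  assumes "exact_coloring G r c" "r < 3"
  shows "\<not> has_rainbow_3ap G c"
proof
  assume "has_rainbow_3ap G c"
  then obtain S where S: "S \<subseteq> pverts G" "card S = 3" "inj_on c S"
    by (auto simp: has_rainbow_3ap_def is_3ap_def rainbow_def)
  then have "card (c ` S) = 3" by (simp add: card_image)
  moreover have "c ` S \<subseteq> {1..r}" using assms S by (auto simp: exact_coloring_def)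
  ultimately show False using assms card_mono[of "{1..r}" "c ` S"] by simp
qed

theorem theorem6:
  fixes G :: "'a pair_pre_digraph" and k :: nat
  assumes "k \<ge> 1"
    and "pair_graph G"
    and "Digraph_Component.connected (with_proj G)"
    and "card (pverts G) \<ge> 2"
  shows "aw3 (G \<box> cycle_graph (2 * k + 1)) = 3"
proof -
  let ?P = "G \<box> cycle_graph (2 * k + 1)"
  have three: "has_rainbow_3ap ?P c" if "exact_coloring ?P 3 c" for c
    by (rule exact_three_coloring_has_rainbow_3ap[OF assms that])
  obtain x where "x \<in> pverts G" using assms(4) by fastforce
  \<comment> \<open>A single column already has three vertices, as the cycle has length at least
    3.\<close>
  then have "distinct [(x, 0 :: nat), (x, 1), (x, 2)]" "{(x, 0), (x, 1), (x, 2)} \<subseteq> pverts ?P"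
    using assms(1) by (auto simp: cart_prod_def cycle_graph_def)
  note ex = exact_coloring_exists[OF this]
  have "(LEAST r. 0 < r \<and> (\<forall>c. exact_coloring ?P r c \<longrightarrow> has_rainbow_3ap ?P c)) = 3"
  proof (rule Least_equality)
    fix r assume r: "0 < r \<and> (\<forall>c. exact_coloring ?P r c \<longrightarrow> has_rainbow_3ap ?P c)"
    show "3 \<le> r"
    proof (rule ccontr)
      assume less: "\<not> 3 \<le> r"
      then have "r = 1 \<or> r = 2" using r by linarith
      then obtain c where "exact_coloring ?P r c" using ex by blast
      then show False using r less no_rainbow_3ap_few_colors[of ?P r c] by auto
    qed
  qed (use three in auto)
  then show ?thesis using ex(3) three unfolding aw3_def by auto
qed

end
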